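(* Let $N$ be a compact manifold of dimension $n$. Let $f$ be an embedding of $N$ into an open subset $U$ of $\mathbb{R}^m$. Let $F:U\to\mathbb{R}^\ell$ be a mapping. If $\ell>2n$, then there exists a subset $\Sigma$ of $\mathcal{L}(\mathbb{R}^m,\mathbb{R}^\ell)$ with Lebesgue measure zero such that for any $\pi\in\mathcal{L}(\mathbb{R}^m,\mathbb{R}^\ell)-\Sigma$, the mapping $F_\pi\circ f:N\to\mathbb{R}^\ell$ is an embedding.
   Context: Conventions: $\ell,m,n$ are positive integers; all manifolds and mappings are of class $C^\infty$ and all manifolds are without boundary. $\mathcal{L}(\mathbb{R}^m,\mathbb{R}^\ell)$ is the space of all linear mappings $\mathbb{R}^m\to\mathbb{R}^\ell$, identified with $(\mathbb{R}^m)^\ell$ (via matrices), which gives it Lebesgue measure. For $\pi\in\mathcal{L}(\mathbb{R}^m,\mathbb{R}^\ell)$ and $F:U\to\mathbb{R}^\ell$, $F_\pi=F+\pi|_U:U\to\mathbb{R}^\ell$. *)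

theory Defs
  imports "HOL-Analysis.Analysis"
begin

(* Ck_on and smooth_on are meant for open S. On an open subset of a Euclidean space a map is
   C^(k+1) iff it is differentiable and all its directional derivatives (one for each fixed
   direction v) are C^k. *)
primrec Ck_on :: "nat \<Rightarrow> ('a::euclidean_space \<Rightarrow> 'b::euclidean_space) \<Rightarrow> 'a set \<Rightarrow> bool" where
  "Ck_on 0 f S \<longleftrightarrow> continuous_on S f"
| "Ck_on (Suc k) f S \<longleftrightarrow>
     (\<forall>x\<in>S. f differentiable (at x)) \<and>
     (\<forall>v. Ck_on k (\<lambda>x. frechet_derivative f (at x) v) S)"

definition smooth_on :: "('a::euclidean_space \<Rightarrow> 'b::euclidean_space) \<Rightarrow> 'a set \<Rightarrow> bool" where
  "smooth_on f S \<longleftrightarrow> (\<forall>k. Ck_on k f S)"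

(* A chart is a pair (V, \<phi>) of its domain and a function whose values outside V are irrelevant.
   Its inverse is inv_into V \<phi>. *)
definition smooth_atlas ::
    "'a topology \<Rightarrow> ('a set \<times> ('a \<Rightarrow> 'e::euclidean_space)) set \<Rightarrow> bool" where
  "smooth_atlas X A \<longleftrightarrow>
     (\<Union>(V, \<phi>)\<in>A. V) = topspace X \<and>
     (\<forall>(V, \<phi>)\<in>A. openin X V \<and> open (\<phi> ` V) \<and>
        homeomorphic_map (subtopology X V) (top_of_set (\<phi> ` V)) \<phi>) \<and>
     (\<forall>(V, \<phi>)\<in>A. \<forall>(W, \<psi>)\<in>A. smooth_on (\<psi> \<circ> inv_into V \<phi>) (\<phi> ` (V \<inter> W)))"

(* The dimension is that of the model space 'e. The atlas need not be maximal: it generates a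
   unique smooth structure, and the notions below depend only on that structure. *)
definition smooth_manifold ::
    "'a topology \<Rightarrow> ('a set \<times> ('a \<Rightarrow> 'e::euclidean_space)) set \<Rightarrow> bool" where
  "smooth_manifold X A \<longleftrightarrow>
     Hausdorff_space X \<and> second_countable X \<and> smooth_atlas X A"

definition smooth_map ::
    "'a topology \<Rightarrow> ('a set \<times> ('a \<Rightarrow> 'e::euclidean_space)) set \<Rightarrow> 'b set
       \<Rightarrow> ('a \<Rightarrow> 'b::euclidean_space) \<Rightarrow> bool" where
  "smooth_map X A U g \<longleftrightarrow>
     g ` topspace X \<subseteq> U \<and>
     (\<forall>(V, \<phi>)\<in>A. smooth_on (g \<circ> inv_into V \<phi>) (\<phi> ` V))"

(* The target manifold is an open subset U of a Euclidean space with its standard structure, so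
   the differential of g at p is represented by the derivative of g read in a chart around p. *)
definition immersion ::
    "'a topology \<Rightarrow> ('a set \<times> ('a \<Rightarrow> 'e::euclidean_space)) set \<Rightarrow> 'b set
       \<Rightarrow> ('a \<Rightarrow> 'b::euclidean_space) \<Rightarrow> bool" where
  "immersion X A U g \<longleftrightarrow>
     smooth_map X A U g \<and>
     (\<forall>(V, \<phi>)\<in>A. \<forall>p\<in>V. inj (frechet_derivative (g \<circ> inv_into V \<phi>) (at (\<phi> p))))"

definition smooth_embedding ::
    "'a topology \<Rightarrow> ('a set \<times> ('a \<Rightarrow> 'e::euclidean_space)) set \<Rightarrow> 'b set
       \<Rightarrow> ('a \<Rightarrow> 'b::euclidean_space) \<Rightarrow> bool" where
  "smooth_embedding X A U g \<longleftrightarrow>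
     immersion X A U g \<and> embedding_map X (top_of_set U) g"

definition linear_perturbation ::
    "(real^'m \<Rightarrow> real^'l) \<Rightarrow> (real^'m \<Rightarrow> real^'l) \<Rightarrow> (real^'m \<Rightarrow> real^'l)" where
  "linear_perturbation F \<pi> = (\<lambda>x. F x + \<pi> x)"

(* Lebesgue measure on the space of linear maps comes from its identification with matrices. *)
definition null_set_of_linear_maps :: "(real^'m \<Rightarrow> real^'l) set \<Rightarrow> bool" where
  "null_set_of_linear_maps \<Sigma> \<longleftrightarrow>
     \<Sigma> \<subseteq> {\<pi>. linear \<pi>} \<and> matrix ` \<Sigma> \<in> null_sets (lebesgue :: (real^'m^'l) measure)"

end

theory Submission
  imports Defs
begin

text \<open>
  Identify linear maps with matrices \<open>M\<close>. Because \<open>N\<close> is compact, finitely many charts cover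
  it, and every injective immersion of \<open>N\<close> is an embedding. Each of the two ways for \<open>F\<^sub>\<pi> \<circ> f\<close> to fail
  is a linear equation \<open>M w = b\<close> whose data depend on \<open>2n\<close> real parameters:

  \<^item> a double point \<open>F\<^sub>\<pi> (f p) = F\<^sub>\<pi> (f q)\<close> means \<open>M w = b\<close> with \<open>w = f p - f q\<close> and
    \<open>b = F (f q) - F (f p)\<close>, where the parameters are the coordinates of \<open>p\<close> and \<open>q\<close>;

  \<^item> a tangent vector \<open>v\<close> at \<open>p\<close> killed by the differential means \<open>M w = b\<close> with \<open>w = Df v\<close> and
    \<open>b = - D(F \<circ> f) v\<close>, where the parameters are the coordinates of \<open>p\<close> and \<open>v\<close>.

  In both cases \<open>w \<noteq> 0\<close>, because \<open>f\<close> is injective and is an immersion. For a fixed \<open>w \<noteq> 0\<close> the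
  equation \<open>M w = b\<close> cuts out an affine subspace of codimension \<open>\<ell>\<close>, so letting the \<open>2n < \<ell>\<close>
  parameters vary sweeps out a set of measure zero. This counting argument is
  \<open>negligible_affine_condition\<close>. In place of Sard's theorem it needs only that a differentiable map
  between spaces of the same dimension maps null sets to null sets: the bad matrices form a finite
  union of such images of subsets of hyperplanes.

  The other ingredients are the chain rule for \<open>C\<^sup>k\<close> maps, which makes \<open>F\<^sub>\<pi> \<circ> f\<close> smooth
  (\<open>Ck_on_compose\<close>), and the independence of the immersion condition from the chart
  (\<open>immersion_if_on_cover\<close>). The latter lets the finite cover control an atlas that may have
  uncountably many charts, for which a union of null sets need not be null.
\<close>

section \<open>Calculus of smooth maps\<close>

lemma Ck_on_cong:
  assumes "open S" "\<And>x. x \<in> S \<Longrightarrow> f x = g x" "Ck_on k f S"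
  shows "Ck_on k g S"
  using assms(2,3)
proof (induction k arbitrary: f g)
  case 0
  then show ?case by (metis Ck_on.simps(1) continuous_on_cong)
next
  case (Suc k)
  have deriv: "(g has_derivative frechet_derivative f (at x)) (at x)" if "x \<in> S" for x
    using has_derivative_transform_within_open[OF _ assms(1) that Suc.prems(1)]
      Suc.prems(2) that by (simp add: frechet_derivative_works)
  then have eq: "frechet_derivative f (at x) v = frechet_derivative g (at x) v" if "x \<in> S" for x v
    using frechet_derivative_at that by metis
  have "Ck_on k (\<lambda>x. frechet_derivative g (at x) v) S" for v
    using Suc.prems(2) by (intro Suc.IH[OF eq]) auto
  moreover have "\<forall>x\<in>S. g differentiable (at x)"
    using deriv by (meson differentiableI)
  ultimately show ?case by simp
qed

text \<open>Any explicit formula for the derivative on \<open>S\<close> can serve in place of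
  \<^const>\<open>frechet_derivative\<close>; the closure properties below are inductions on \<open>k\<close> that use it.\<close>
lemma Ck_on_SucI:
  assumes "open S" "\<And>x. x \<in> S \<Longrightarrow> (f has_derivative f' x) (at x)"
    and "\<And>v. Ck_on k (\<lambda>x. f' x v) S"
  shows "Ck_on (Suc k) f S"
proof -
  have "f' x v = frechet_derivative f (at x) v" if "x \<in> S" for x v
    using frechet_derivative_at assms(2) that by metis
  then have "Ck_on k (\<lambda>x. frechet_derivative f (at x) v) S" for v
    by (rule Ck_on_cong[OF assms(1) _ assms(3)])
  then show ?thesis
    using assms(2) by (auto simp: differentiable_def)
qed

lemma Ck_on_has_derivative:
  "Ck_on (Suc k) f S \<Longrightarrow> x \<in> S \<Longrightarrow> (f has_derivative frechet_derivative f (at x)) (at x)"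
  by (simp add: frechet_derivative_works)

lemma Ck_on_SucD: "Ck_on (Suc k) f S \<Longrightarrow> Ck_on k f S"
proof (induction k arbitrary: f)
  case 0
  then show ?case
    by (auto intro: continuous_at_imp_continuous_on differentiable_imp_continuous_within)
next
  case (Suc k)
  then show ?case by (simp only: Ck_on.simps) blast
qed

lemma Ck_on_bounded_linear:
  assumes "open S" "bounded_linear h" "Ck_on k f S"
  shows "Ck_on k (\<lambda>x. h (f x)) S"
  using assms(3)
proof (induction k arbitrary: f)
  case 0
  then show ?case
    by (simp add: bounded_linear.continuous_on[OF assms(2)])
next
  case (Suc k)
  show ?case
  proof (rule Ck_on_SucI[OF assms(1)])
    show "((\<lambda>x. h (f x)) has_derivative (\<lambda>v. h (frechet_derivative f (at x) v))) (at x)"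
      if "x \<in> S" for x
      using bounded_linear.has_derivative[OF assms(2)] Ck_on_has_derivative[OF Suc.prems that] by blast
  qed (use Suc in auto)
qed

lemma Ck_on_add:
  assumes "open S" "Ck_on k f S" "Ck_on k g S"
  shows "Ck_on k (\<lambda>x. f x + g x) S"
  using assms(2,3)
proof (induction k arbitrary: f g)
  case 0
  then show ?case by (simp add: continuous_on_add)
next
  case (Suc k)
  show ?case
  proof (rule Ck_on_SucI[OF assms(1)])
    show "((\<lambda>x. f x + g x) has_derivative
        (\<lambda>v. frechet_derivative f (at x) v + frechet_derivative g (at x) v)) (at x)"
      if "x \<in> S" for x
      using Ck_on_has_derivative Suc.prems that by (blast intro: has_derivative_add)
  qed (use Suc in auto)
qed

lemma Ck_on_const: "Ck_on k (\<lambda>x. c) S"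
  by (induction k arbitrary: c) auto

lemma Ck_on_id: "open S \<Longrightarrow> Ck_on k (\<lambda>x. x) S"
proof (cases k)
  case (Suc j)
  assume "open S"
  then show ?thesis
    unfolding Suc by (rule Ck_on_SucI) (auto intro: Ck_on_const has_derivative_ident)
qed auto

lemma Ck_on_sum:
  assumes "open S" "\<And>i. i \<in> I \<Longrightarrow> Ck_on k (f i) S"
  shows "Ck_on k (\<lambda>x. \<Sum>i\<in>I. f i x) S"
  using assms(2)
  by (induction I rule: infinite_finite_induct) (auto simp: Ck_on_const intro: Ck_on_add[OF assms(1)])

lemma Ck_on_scaleR:
  assumes "open S" "Ck_on k f S" "Ck_on k g S"
  shows "Ck_on k (\<lambda>x. f x *\<^sub>R g x) S"
  using assms(2,3)
proof (induction k arbitrary: f g)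
  case 0
  then show ?case by (simp add: continuous_on_scaleR)
next
  case (Suc k)
  note low = Suc.prems[THEN Ck_on_SucD]
  show ?case
  proof (rule Ck_on_SucI[OF assms(1)])
    show "((\<lambda>x. f x *\<^sub>R g x) has_derivative
        (\<lambda>v. f x *\<^sub>R frechet_derivative g (at x) v + frechet_derivative f (at x) v *\<^sub>R g x)) (at x)"
      if "x \<in> S" for x
      by (rule has_derivative_scaleR Ck_on_has_derivative Suc.prems that)+
    show "Ck_on k (\<lambda>x. f x *\<^sub>R frechet_derivative g (at x) v + frechet_derivative f (at x) v *\<^sub>R g x) S" for v
      using Suc low by (intro Ck_on_add[OF assms(1)] Suc.IH) auto
  qed
qed

lemma linear_expand_Basis:
  fixes h :: "'a::euclidean_space \<Rightarrow> 'b::real_normed_vector"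
  assumes "bounded_linear h"
  shows "h v = (\<Sum>i\<in>Basis. (v \<bullet> i) *\<^sub>R h i)"
proof -
  have "h v = h (\<Sum>i\<in>Basis. (v \<bullet> i) *\<^sub>R i)"
    by (simp add: euclidean_representation)
  then show ?thesis
    using assms by (simp add: linear_sum linear_scale bounded_linear.linear)
qed

text \<open>The chain rule gives \<open>D(F \<circ> g) v = \<Sum>\<^sub>i (Dg v)\<^sub>i \<cdot> (\<partial>\<^sub>i F \<circ> g)\<close>. Expanding in the basis is what makes the
  induction work: the vector in which \<open>F\<close> is differentiated no longer depends on the point, so the
  factors are a component of a \<open>C\<^sup>k\<close> map and a composition covered by the induction hypothesis.\<close>
lemma Ck_on_compose:
  assumes "open S" "open T" "g ` S \<subseteq> T" "Ck_on k F T" "Ck_on k g S"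
  shows "Ck_on k (F \<circ> g) S"
  using assms(4,5)
proof (induction k arbitrary: F)
  case 0
  then show ?case
    using assms(3) by (simp only: Ck_on.simps) (blast intro: continuous_on_compose continuous_on_subset)
next
  case (Suc k)
  let ?D = "\<lambda>x v. \<Sum>i\<in>Basis. (frechet_derivative g (at x) v \<bullet> i) *\<^sub>R frechet_derivative F (at (g x)) i"
  show ?case
  proof (rule Ck_on_SucI[OF assms(1)])
    fix x assume x: "x \<in> S"
    with assms(3) have "g x \<in> T" by auto
    then have F: "(F has_derivative frechet_derivative F (at (g x))) (at (g x))"
      by (rule Ck_on_has_derivative[OF Suc.prems(1)])
    have "(F \<circ> g has_derivative frechet_derivative F (at (g x)) \<circ> frechet_derivative g (at x)) (at x)"
      by (rule diff_chain_at[OF Ck_on_has_derivative[OF Suc.prems(2) x] F])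
    moreover have "frechet_derivative F (at (g x)) \<circ> frechet_derivative g (at x) = ?D x"
      by (rule ext, unfold o_apply) (rule linear_expand_Basis[OF has_derivative_bounded_linear[OF F]])
    ultimately show "(F \<circ> g has_derivative ?D x) (at x)" by simp
  next
    fix v
    have "Ck_on k (\<lambda>x. frechet_derivative g (at x) v \<bullet> i) S" for i
      using Suc.prems(2) by (intro Ck_on_bounded_linear[OF assms(1) bounded_linear_inner_left]) auto
    moreover have "Ck_on k ((\<lambda>y. frechet_derivative F (at y) i) \<circ> g) S" for i
      using Suc.prems Ck_on_SucD by (intro Suc.IH) auto
    ultimately show "Ck_on k (\<lambda>x. ?D x v) S"
      by (intro Ck_on_sum Ck_on_scaleR assms(1)) (auto simp: o_def)
  qed
qed

lemma smooth_on_compose: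
  assumes "open S" "open T" "g ` S \<subseteq> T" "smooth_on F T" "smooth_on g S"
  shows "smooth_on (F \<circ> g) S"
  using assms Ck_on_compose unfolding smooth_on_def by blast

lemma smooth_on_differentiable: "smooth_on f S \<Longrightarrow> x \<in> S \<Longrightarrow> f differentiable (at x)"
  unfolding smooth_on_def by (metis Ck_on.simps(2))

lemma smooth_on_imp_differentiable_on: "smooth_on f S \<Longrightarrow> f differentiable_on S"
  by (simp add: differentiable_on_def differentiable_at_withinI smooth_on_differentiable)

lemma smooth_on_continuous_on: "smooth_on f S \<Longrightarrow> continuous_on S f"
  unfolding smooth_on_def by (metis Ck_on.simps(1))

lemma smooth_on_linear_perturbation:
  assumes "open U" "smooth_on F U" "linear \<pi>"
  shows "smooth_on (linear_perturbation F \<pi>) U"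
  unfolding smooth_on_def linear_perturbation_def
proof
  fix k
  show "Ck_on k (\<lambda>x. F x + \<pi> x) U"
    using assms Ck_on_bounded_linear[OF assms(1) _ Ck_on_id[OF assms(1)], of \<pi> k]
    by (intro Ck_on_add) (auto simp: smooth_on_def linear_conv_bounded_linear)
qed

text \<open>Since the derivative is linear in the vector, \<open>(x, v) \<mapsto> Dg(x) v\<close> is a finite sum of products of
  the coordinates of \<open>v\<close> with partial derivatives of \<open>g\<close> at \<open>x\<close>, each differentiable
  because \<open>g\<close> is \<open>C\<^sup>2\<close>.\<close>
lemma smooth_on_tangent_map_differentiable:
  assumes "smooth_on g S"
  shows "(\<lambda>z. frechet_derivative g (at (fst z)) (snd z)) differentiable_on S \<times> UNIV"
  unfolding differentiable_on_def
proof
  fix z :: "'a \<times> 'a" assume z: "z \<in> S \<times> UNIV"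
  have C2: "Ck_on (Suc (Suc 0)) g S"
    using assms unfolding smooth_on_def by blast
  have d: "(\<lambda>y. frechet_derivative g (at (fst y)) i) differentiable (at z within S \<times> UNIV)" for i
  proof -
    have "(\<lambda>x. frechet_derivative g (at x) i) differentiable (at (fst z))"
      using C2 z by auto
    then have "((\<lambda>x. frechet_derivative g (at x) i) \<circ> fst) differentiable (at z)"
      by (rule differentiable_chain_at[OF bounded_linear_imp_differentiable[OF bounded_linear_fst]])
    then show ?thesis
      by (simp add: o_def differentiable_at_withinI)
  qed
  have s: "(\<lambda>y. snd y \<bullet> i) differentiable (at z within S \<times> UNIV)" for i :: 'a
    by (intro bounded_linear_imp_differentiable
        bounded_linear_compose[OF bounded_linear_inner_left bounded_linear_snd])
  have "(\<lambda>y. \<Sum>i\<in>Basis. (snd y \<bullet> i) *\<^sub>R frechet_derivative g (at (fst y)) i)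
      differentiable (at z within S \<times> UNIV)"
    using d s by (intro differentiable_sum) auto
  moreover have "(\<Sum>i\<in>Basis. (snd y \<bullet> i) *\<^sub>R frechet_derivative g (at (fst y)) i)
      = frechet_derivative g (at (fst y)) (snd y)" if "y \<in> S \<times> UNIV" for y
    using linear_expand_Basis[OF has_derivative_bounded_linear[OF Ck_on_has_derivative[OF C2]]] that
    by (metis mem_Times_iff)
  ultimately show "(\<lambda>y. frechet_derivative g (at (fst y)) (snd y)) differentiable (at z within S \<times> UNIV)"
    using z by (metis (no_types, lifting) differentiable_transform_within zero_less_one)
qed

section \<open>Linear maps meeting a parametrized linear condition\<close>

definition outer_product :: "real^'l \<Rightarrow> real^'m \<Rightarrow> real^'m^'l" where
  "outer_product r a = (\<chi> i k. r $ i * a $ k)"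

lemma outer_product_mult_vec: "outer_product r a *v w = (a \<bullet> w) *\<^sub>R r"
  by (simp add: outer_product_def matrix_vector_mult_def vec_eq_iff inner_vec_def sum_distrib_left mult_ac)

lemma inner_outer_product: "outer_product r a \<bullet> B = r \<bullet> (B *v a)"
  by (simp add: outer_product_def matrix_vector_mult_def inner_vec_def sum_distrib_left mult_ac)

lemma linear_outer_product_left: "linear (\<lambda>r. outer_product r a)"
  by (rule linearI) (simp_all add: outer_product_def vec_eq_iff algebra_simps)

lemma bounded_bilinear_matrix_vector_mult:
  "bounded_bilinear (\<lambda>(B::real^'m^'l) w. B *v w)"
  unfolding bilinear_conv_bounded_bilinear[symmetric] bilinear_def
  by (auto intro!: linearI simp: matrix_vector_mult_add_rdistrib scaleR_matrix_vector_assoc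
      matrix_vector_right_distrib matrix_vector_mult_scaleR)

text \<open>Where \<open>a \<bullet> w p \<noteq> 0\<close>, a solution \<open>B\<close> of \<open>B *v w p = b p\<close> is determined by \<open>p\<close> and the action of
  \<open>B\<close> on the orthogonal complement of the unit vector \<open>a\<close>. The vector \<open>B *v a\<close>, which lies in a space of
  dimension \<open>\<ell> > DIM('p)\<close>, is thus redundant, and \<open>p\<close> itself can be stored in its place by
  means of a linear injection \<open>h\<close>. As the range of \<open>h\<close> lies in a hyperplane, so do the matrices that
  encode such data; the map \<open>G\<close> that decodes them is differentiable, hence preserves null sets.\<close>
lemma negligible_affine_condition_direction:
  fixes w :: "'p::euclidean_space \<Rightarrow> real^'m" and b :: "'p \<Rightarrow> real^'l" and a :: "real^'m"
  assumes dim: "DIM('p) < CARD('l)"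
    and w: "w differentiable_on S" and b: "b differentiable_on S"
    and a: "a \<bullet> a = 1" and nz: "\<And>p. p \<in> S \<Longrightarrow> a \<bullet> w p \<noteq> 0"
  shows "negligible {B. \<exists>p\<in>S. B *v w p = b p}"
proof -
  obtain h :: "'p \<Rightarrow> real^'l" where h: "linear h" "inj h"
  proof -
    obtain h :: "'p \<Rightarrow> real^'l" where h: "linear h" "\<And>p. norm (h p) = norm p"
      using isometry_subset_subspace[of "UNIV :: 'p set" "UNIV :: (real^'l) set"] dim by auto
    then have "inj h"
      by (metis linear_injective_0 norm_eq_zero)
    then show ?thesis using h(1) that by blast
  qed
  obtain L where L: "linear L" "\<And>p. L (h p) = p"
    using linear_injective_left_inverse[OF h] by (auto simp: fun_eq_iff)
  have "dim (range h) < DIM(real^'l)"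
    using dim_image_le[OF h(1), of UNIV] dim by simp
  then obtain c where c: "c \<noteq> 0" "\<And>p. c \<bullet> h p = 0"
    using lowdim_subset_hyperplane span_superset by (metis (mono_tags) mem_Collect_eq rangeI subset_iff)
  define Z where "Z = {B. outer_product c a \<bullet> B = 0 \<and> L (B *v a) \<in> S}"
  \<comment> \<open>\<open>P\<close> reads off the stored parameter. \<open>G\<close> changes only the value on \<open>a\<close>, by the unique amount
    that makes the equation hold.\<close>
  define P where "P = (\<lambda>B::real^'m^'l. L (B *v a))"
  define G where "G = (\<lambda>B. B + outer_product (inverse (a \<bullet> w (P B)) *\<^sub>R (b (P B) - B *v w (P B))) a)"
  have "outer_product c a \<noteq> 0"
    using c(1) a outer_product_mult_vec[of c a a] by auto
  then have "negligible {B. outer_product c a \<bullet> B = 0}"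
    by (intro negligible_hyperplane) auto
  then have "negligible Z"
    by (rule negligible_subset) (auto simp: Z_def)
  moreover have "G differentiable_on Z"
  proof -
    have P: "P differentiable_on Z"
      unfolding P_def
      by (intro linear_imp_differentiable_on linear_compose[OF _ L(1), unfolded o_def]
          bounded_linear.linear[OF bounded_bilinear.bounded_linear_left[OF bounded_bilinear_matrix_vector_mult]])
    have "P ` Z \<subseteq> S"
      by (auto simp: P_def Z_def)
    then have wP: "(\<lambda>B. w (P B)) differentiable_on Z" and bP: "(\<lambda>B. b (P B)) differentiable_on Z"
      using differentiable_on_compose[OF P] w b differentiable_on_subset by blast+
    have aw: "(\<lambda>B. a \<bullet> w (P B)) differentiable_on Z"
      using differentiable_on_compose[OF wP, of "(\<bullet>) a"]
      by (auto intro: bounded_linear_imp_differentiable_on bounded_linear_inner_right)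
    have Bw: "(\<lambda>B. B *v w (P B)) differentiable_on Z"
      using bounded_bilinear.FDERIV[OF bounded_bilinear_matrix_vector_mult has_derivative_ident] wP
      unfolding differentiable_on_def differentiable_def by blast
    have "(\<lambda>B. inverse (a \<bullet> w (P B)) *\<^sub>R (b (P B) - B *v w (P B))) differentiable_on Z" (is "?r differentiable_on Z")
      using aw Bw bP nz by (intro differentiable_on_scaleR differentiable_on_inverse differentiable_on_diff)
        (auto simp: Z_def P_def)
    then have "(\<lambda>B. outer_product (?r B) a) differentiable_on Z"
      by (rule differentiable_on_compose) (intro linear_imp_differentiable_on linear_outer_product_left)
    then show ?thesis
      unfolding G_def by (intro differentiable_on_add) (auto simp: differentiable_on_def)
  qed
  ultimately have "negligible (G ` Z)"
    by (intro negligible_differentiable_image_negligible) auto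
  moreover have "{B. \<exists>p\<in>S. B *v w p = b p} \<subseteq> G ` Z"
  proof clarify
    fix B p assume p: "p \<in> S" and B: "B *v w p = b p"
    \<comment> \<open>The code of \<open>B\<close>: overwrite its value on \<open>a\<close> by \<open>h p\<close>.\<close>
    define B0 where "B0 = B + outer_product (h p - B *v a) a"
    have col: "B0 *v a = h p"
      by (simp add: B0_def matrix_vector_mult_add_rdistrib outer_product_mult_vec a)
    have "B0 *v w p - b p = (a \<bullet> w p) *\<^sub>R (h p - B *v a)"
      by (simp add: B0_def matrix_vector_mult_add_rdistrib outer_product_mult_vec B)
    then have r: "inverse (a \<bullet> w p) *\<^sub>R (b p - B0 *v w p) = - (h p - B *v a)"
      using nz[OF p] by (metis (no_types, lifting) left_inverse minus_diff_eq scaleR_minus_right scaleR_one scaleR_scaleR)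
    have "P B0 = p"
      by (simp add: P_def col L)
    then have "G B0 = B0 + outer_product (- (h p - B *v a)) a"
      by (simp add: G_def r del: minus_diff_eq)
    then have "G B0 = B"
      by (simp add: B0_def linear_neg[OF linear_outer_product_left] del: minus_diff_eq)
    moreover have "B0 \<in> Z"
      using p by (simp add: Z_def inner_outer_product col c L)
    ultimately show "B \<in> G ` Z" by blast
  qed
  ultimately show ?thesis
    by (rule negligible_subset)
qed

text \<open>A nonzero \<open>w p\<close> has a nonzero coordinate, so the finitely many basis vectors \<open>a\<close> suffice.\<close>
lemma negligible_affine_condition:
  fixes w :: "'p::euclidean_space \<Rightarrow> real^'m" and b :: "'p \<Rightarrow> real^'l"
  assumes "DIM('p) < CARD('l)" "w differentiable_on S" "b differentiable_on S"
    and nz: "\<And>p. p \<in> S \<Longrightarrow> w p \<noteq> 0"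
  shows "negligible {B. \<exists>p\<in>S. B *v w p = b p}"
proof -
  let ?S = "\<lambda>a. {p\<in>S. a \<bullet> w p \<noteq> 0}"
  have "negligible {B. \<exists>p\<in>?S a. B *v w p = b p}" if "a \<in> Basis" for a
    using that assms by (intro negligible_affine_condition_direction[where a = a])
      (auto intro: differentiable_on_subset simp: inner_Basis)
  then have "negligible (\<Union>a\<in>Basis. {B. \<exists>p\<in>?S a. B *v w p = b p})"
    by (intro negligible_Union) auto
  then show ?thesis
    by (rule negligible_subset)
      (use nz in \<open>auto, metis euclidean_all_zero_iff inner_commute\<close>)
qed

section \<open>Perturbations that are singular or not injective\<close>

text \<open>The parameters are the pairs of a point and a nonzero tangent vector at it; an immersion \<open>g\<close> sends
  the latter to a nonzero vector, as \<open>negligible_affine_condition\<close> demands.\<close>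
lemma negligible_nonimmersive_perturbations:
  fixes g :: "'e::euclidean_space \<Rightarrow> real^'m" and G :: "'e \<Rightarrow> real^'l"
  assumes "2 * DIM('e) < CARD('l)" "smooth_on g S" "smooth_on G S"
    and inj: "\<And>x. x \<in> S \<Longrightarrow> inj (frechet_derivative g (at x))"
  shows "negligible {B. \<exists>x\<in>S. \<not> inj (\<lambda>v. frechet_derivative G (at x) v + B *v frechet_derivative g (at x) v)}"
proof -
  let ?R = "S \<times> (UNIV - {0})"
  let ?w = "\<lambda>z. frechet_derivative g (at (fst z)) (snd z)"
  let ?b = "\<lambda>z. - frechet_derivative G (at (fst z)) (snd z)"
  have lin: "linear (frechet_derivative h (at x))" if "smooth_on h S" "x \<in> S"
    for x and h :: "'e \<Rightarrow> 'c::euclidean_space"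
    using smooth_on_differentiable[OF that] by (rule linear_frechet_derivative)
  have "negligible {B. \<exists>z\<in>?R. B *v ?w z = ?b z}"
  proof (rule negligible_affine_condition)
    show "?w differentiable_on ?R" "?b differentiable_on ?R"
      using assms(2,3)[THEN smooth_on_tangent_map_differentiable]
      by (auto intro: differentiable_on_subset differentiable_on_minus)
    show "?w z \<noteq> 0" if "z \<in> ?R" for z
      using that inj lin[OF assms(2)] by (auto simp: linear_injective_0)
  qed (use assms(1) in simp)
  moreover have "{B. \<exists>x\<in>S. \<not> inj (\<lambda>v. frechet_derivative G (at x) v + B *v frechet_derivative g (at x) v)}
      \<subseteq> {B. \<exists>z\<in>?R. B *v ?w z = ?b z}"
  proof clarify
    fix B x assume x: "x \<in> S"
      and ninj: "\<not> inj (\<lambda>v. frechet_derivative G (at x) v + B *v frechet_derivative g (at x) v)"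
    have "linear (\<lambda>v. frechet_derivative G (at x) v + B *v frechet_derivative g (at x) v)"
      using lin[OF assms(2) x] lin[OF assms(3) x]
      by (intro linear_compose_add linear_compose[unfolded o_def, OF _ matrix_vector_mul_linear])
    with ninj obtain v where "v \<noteq> 0"
      "frechet_derivative G (at x) v + B *v frechet_derivative g (at x) v = 0"
      by (auto simp: linear_injective_0)
    then show "\<exists>z\<in>?R. B *v ?w z = ?b z"
      using x by (intro bexI[of _ "(x, v)"]) (auto simp: add_eq_0_iff)
  qed
  ultimately show ?thesis by (rule negligible_subset)
qed

text \<open>Two maps \<open>g\<close> and \<open>g'\<close> are allowed so that they can be one embedding read in two charts: two points
  that are identified by a perturbation need not lie in a common chart.\<close>
lemma negligible_noninjective_perturbations:
  fixes g g' :: "'e::euclidean_space \<Rightarrow> real^'m" and G G' :: "'e \<Rightarrow> real^'l"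
  assumes dim: "2 * DIM('e) < CARD('l)"
    and S: "g differentiable_on S" "G differentiable_on S"
    and T: "g' differentiable_on T" "G' differentiable_on T"
  shows "negligible {B. \<exists>x\<in>S. \<exists>y\<in>T. g x \<noteq> g' y \<and> G x + B *v g x = G' y + B *v g' y}"
proof -
  let ?R = "{z \<in> S \<times> T. g (fst z) \<noteq> g' (snd z)}"
  let ?w = "\<lambda>z. g (fst z) - g' (snd z)"
  let ?b = "\<lambda>z. G' (snd z) - G (fst z)"
  have fst: "(\<lambda>z. h (fst z)) differentiable_on ?R" if "h differentiable_on S"
    for h :: "'e \<Rightarrow> 'c::euclidean_space"
    by (rule differentiable_on_compose[OF bounded_linear_imp_differentiable_on[OF bounded_linear_fst]])
      (auto intro: differentiable_on_subset[OF that])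
  have snd: "(\<lambda>z. h (snd z)) differentiable_on ?R" if "h differentiable_on T"
    for h :: "'e \<Rightarrow> 'c::euclidean_space"
    by (rule differentiable_on_compose[OF bounded_linear_imp_differentiable_on[OF bounded_linear_snd]])
      (auto intro: differentiable_on_subset[OF that])
  have "negligible {B. \<exists>z\<in>?R. B *v ?w z = ?b z}"
    using dim S T by (intro negligible_affine_condition differentiable_on_diff fst snd) auto
  then show ?thesis
  proof (rule negligible_subset, clarify)
    fix B x y
    assume "x \<in> S" "y \<in> T" "g x \<noteq> g' y" "G x + B *v g x = G' y + B *v g' y"
    then show "\<exists>z\<in>?R. B *v ?w z = ?b z"
      by (intro bexI[of _ "(x, y)"]) (auto simp: matrix_vector_mult_diff_distrib algebra_simps)
  qed
qed

section \<open>Charts and immersions\<close>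

lemma
  assumes "smooth_atlas X A" "(V, \<phi>) \<in> A"
  shows chart_openin: "openin X V"
    and chart_inj_on: "inj_on \<phi> V"
    and chart_open_image: "openin X W \<Longrightarrow> open (\<phi> ` (V \<inter> W))"
proof -
  have V: "openin X V" "open (\<phi> ` V)"
    and hom: "homeomorphic_map (subtopology X V) (top_of_set (\<phi> ` V)) \<phi>"
    using assms by (auto simp: smooth_atlas_def)
  show "openin X V" by (fact V)
  have top: "topspace (subtopology X V) = V"
    using openin_subset[OF V(1)] by auto
  show "inj_on \<phi> V"
    using hom top by (metis homeomorphic_eq_everything_map)
  assume "openin X W"
  then have "openin (subtopology X V) (V \<inter> W)"
    by (metis openin_subtopology_Int2)
  then have "openin (top_of_set (\<phi> ` V)) (\<phi> ` (V \<inter> W))"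
    using homeomorphic_map_openness_eq[OF hom] by blast
  then show "open (\<phi> ` (V \<inter> W))"
    using V(2) openin_open_eq by blast
qed

lemma frechet_derivative_change_of_chart:
  fixes h :: "'a \<Rightarrow> 'c::euclidean_space"
  assumes X: "smooth_atlas X A" and V: "(V, \<phi>) \<in> A" "p \<in> V" and W: "(W, \<psi>) \<in> A" "p \<in> W"
    and h: "(h \<circ> inv_into V \<phi>) differentiable (at (\<phi> p))"
  shows "frechet_derivative (h \<circ> inv_into W \<psi>) (at (\<psi> p)) =
    frechet_derivative (h \<circ> inv_into V \<phi>) (at (\<phi> p)) \<circ>
    frechet_derivative (\<phi> \<circ> inv_into W \<psi>) (at (\<psi> p))"
proof -
  let ?\<tau> = "\<phi> \<circ> inv_into W \<psi>"
  let ?S = "\<psi> ` (W \<inter> V)"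
  have inj: "inj_on \<phi> V" "inj_on \<psi> W"
    using chart_inj_on X V W by blast+
  have "smooth_on ?\<tau> ?S"
    using X V W unfolding smooth_atlas_def by fast
  then have \<tau>: "?\<tau> differentiable (at (\<psi> p))"
    using V W by (intro smooth_on_differentiable) auto
  have \<tau>p: "?\<tau> (\<psi> p) = \<phi> p"
    using W inj by simp
  have d: "((h \<circ> inv_into V \<phi>) \<circ> ?\<tau>) differentiable (at (\<psi> p))"
    using \<tau> h \<tau>p by (intro differentiable_chain_at) auto
  have "frechet_derivative (h \<circ> inv_into W \<psi>) (at (\<psi> p)) =
      frechet_derivative ((h \<circ> inv_into V \<phi>) \<circ> ?\<tau>) (at (\<psi> p))"
    using chart_open_image[OF X W(1) chart_openin[OF X V(1)]] V W inj
    by (intro frechet_derivative_transform_within_open[OF d, symmetric]) auto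
  also have "\<dots> = frechet_derivative (h \<circ> inv_into V \<phi>) (at (\<phi> p)) \<circ> frechet_derivative ?\<tau> (at (\<psi> p))"
    using \<tau> h \<tau>p by (metis frechet_derivative_compose)
  finally show ?thesis .
qed

text \<open>Apply the change of chart to \<open>h = \<psi>\<close>: read in the chart \<open>\<psi>\<close> it is the identity, whose
  derivative therefore factors through that of the transition map.\<close>
lemma inj_frechet_derivative_transition:
  assumes X: "smooth_atlas X A" and V: "(V, \<phi>) \<in> A" "p \<in> V" and W: "(W, \<psi>) \<in> A" "p \<in> W"
  shows "inj (frechet_derivative (\<phi> \<circ> inv_into W \<psi>) (at (\<psi> p)))"
proof -
  have "smooth_on (\<psi> \<circ> inv_into V \<phi>) (\<phi> ` (V \<inter> W))"
    using X V W unfolding smooth_atlas_def by fast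
  then have d: "(\<psi> \<circ> inv_into V \<phi>) differentiable (at (\<phi> p))"
    using V W by (intro smooth_on_differentiable) auto
  have "open (\<psi> ` W)"
    using chart_open_image[OF X W(1) chart_openin[OF X W(1)]] by simp
  then have "(\<psi> \<circ> inv_into W \<psi> has_derivative id) (at (\<psi> p))"
    using W by (intro has_derivative_transform_within_open[OF has_derivative_id[unfolded id_def[symmetric]]])
      (auto simp: f_inv_into_f)
  then have "id = frechet_derivative (\<psi> \<circ> inv_into W \<psi>) (at (\<psi> p))"
    by (rule frechet_derivative_at)
  then show ?thesis
    using frechet_derivative_change_of_chart[OF X V W d] by (metis inj_on_id inj_on_imageI2)
qed

text \<open>By the chain rule, derivatives in two charts differ by the derivative of the transition map,
  which is injective. Injectivity thus has to be checked in one chart around each point only.\<close>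
lemma immersion_if_on_cover:
  assumes X: "smooth_atlas X A" and h: "smooth_map X A U h"
    and B: "B \<subseteq> A" "topspace X \<subseteq> (\<Union>(V, \<phi>)\<in>B. V)"
    and inj: "\<And>V \<phi> p. (V, \<phi>) \<in> B \<Longrightarrow> p \<in> V \<Longrightarrow> inj (frechet_derivative (h \<circ> inv_into V \<phi>) (at (\<phi> p)))"
  shows "immersion X A U h"
  unfolding immersion_def
proof (intro conjI h, clarify)
  fix W \<psi> p assume W: "(W, \<psi>) \<in> A" "p \<in> W"
  then have "p \<in> topspace X"
    using chart_openin[OF X] openin_subset by blast
  with B(2) obtain V \<phi> where V: "(V, \<phi>) \<in> B" "p \<in> V" by blast
  then have VA: "(V, \<phi>) \<in> A" using B(1) by blast
  have "(h \<circ> inv_into V \<phi>) differentiable (at (\<phi> p))"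
    using h VA V(2) by (auto simp: smooth_map_def intro!: smooth_on_differentiable)
  from frechet_derivative_change_of_chart[OF X VA V(2) W this]
  show "inj (frechet_derivative (h \<circ> inv_into W \<psi>) (at (\<psi> p)))"
    using inj_compose[OF inj[OF V] inj_frechet_derivative_transition[OF X VA V(2) W]] by simp
qed

lemma smooth_map_compose:
  assumes X: "smooth_atlas X A" and U: "open U" and f: "smooth_map X A U f"
    and F: "smooth_on F U" "F ` U \<subseteq> U'"
  shows "smooth_map X A U' (F \<circ> f)"
  unfolding smooth_map_def
proof (intro conjI, goal_cases)
  case 1
  then show ?case using f F(2) by (auto simp: smooth_map_def)
next
  case 2
  show ?case
  proof clarify
    fix V \<phi> assume V: "(V, \<phi>) \<in> A"
    have "V \<subseteq> topspace X"
      using openin_subset[OF chart_openin[OF X V]] .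
    then have "(f \<circ> inv_into V \<phi>) ` (\<phi> ` V) \<subseteq> U"
      using f chart_inj_on[OF X V] unfolding smooth_map_def by fastforce
    moreover have "open (\<phi> ` V)"
      using chart_open_image[OF X V chart_openin[OF X V]] by simp
    ultimately have "smooth_on (F \<circ> (f \<circ> inv_into V \<phi>)) (\<phi> ` V)"
      using f V U F(1) by (intro smooth_on_compose) (auto simp: smooth_map_def)
    then show "smooth_on ((F \<circ> f) \<circ> inv_into V \<phi>) (\<phi> ` V)"
      by (simp add: o_assoc)
  qed
qed

lemma null_set_of_linear_maps_if_negligible:
  fixes Z :: "(real^'m^'l) set"
  assumes "negligible Z"
  shows "null_set_of_linear_maps {\<pi>. linear \<pi> \<and> matrix \<pi> \<in> Z}"
proof -
  have "negligible (matrix ` {\<pi>. linear \<pi> \<and> matrix \<pi> \<in> Z})"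
    using assms by (rule negligible_subset) auto
  then show ?thesis
    by (auto simp: null_set_of_linear_maps_def negligible_iff_null_sets)
qed

lemma finite_chart_cover:
  assumes "smooth_atlas X A" "compact_space X"
  obtains B where "finite B" "B \<subseteq> A" "topspace X \<subseteq> (\<Union>(V, \<phi>)\<in>B. V)"
proof -
  have "\<forall>V\<in>fst ` A. openin X V" "topspace X \<subseteq> \<Union>(fst ` A)"
    using assms(1) chart_openin[OF assms(1)] by (force simp: smooth_atlas_def)+
  then obtain \<F> where "finite \<F>" "\<F> \<subseteq> fst ` A" "topspace X \<subseteq> \<Union>\<F>"
    using assms(2) unfolding compact_space_alt by meson
  then obtain B where "finite B" "B \<subseteq> A" "topspace X \<subseteq> \<Union>(fst ` B)"
    by (metis finite_subset_image)
  then show ?thesis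
    using that by (force simp: split_beta)
qed

section \<open>Generic linear perturbations of an embedding\<close>

theorem corollary7:
  fixes N :: "'a topology"
    and A :: "('a set \<times> ('a \<Rightarrow> real^'n)) set"
    and U :: "(real^'m) set"
    and f :: "'a \<Rightarrow> real^'m"
    and F :: "real^'m \<Rightarrow> real^'l"
  assumes "smooth_manifold N A" and "compact_space N"
    and "open U"
    and "smooth_embedding N A U f"
    and "smooth_on F U"
    and "CARD('l) > 2 * CARD('n)"
  shows "\<exists>\<Sigma>. null_set_of_linear_maps \<Sigma> \<and>
           (\<forall>\<pi>\<in>{\<pi>. linear \<pi>} - \<Sigma>.
              smooth_embedding N A UNIV (linear_perturbation F \<pi> \<circ> f))"
proof -
  have atlas: "smooth_atlas N A"
    using assms(1) by (simp add: smooth_manifold_def)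
  obtain B where B: "finite B" "B \<subseteq> A" "topspace N \<subseteq> (\<Union>(V, \<phi>)\<in>B. V)"
    using finite_chart_cover[OF atlas assms(2)] .
  have imm: "immersion N A U f" and emb: "embedding_map N (top_of_set U) f"
    using assms(4) by (auto simp: smooth_embedding_def)
  then have smooth: "smooth_map N A U f"
    by (simp add: immersion_def)
  have dim: "2 * DIM(real^'n) < CARD('l)"
    using assms(6) by simp
  \<comment> \<open>\<open>lf c\<close> is \<open>f\<close> read in the chart \<open>c\<close>, and \<open>im c\<close> is the image of that chart in the model space.\<close>
  define lf where "lf = (\<lambda>c :: 'a set \<times> ('a \<Rightarrow> real^'n). f \<circ> inv_into (fst c) (snd c))"
  define im where "im = (\<lambda>c :: 'a set \<times> ('a \<Rightarrow> real^'n). snd c ` fst c)"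
  have lf: "smooth_on (lf c) (im c)" and lF: "smooth_on (F \<circ> lf c) (im c)" if "c \<in> B" for c
    using smooth smooth_map_compose[OF atlas assms(3) smooth assms(5), of UNIV] that B(2)
    by (auto simp: smooth_map_def lf_def im_def o_assoc[symmetric] split_beta)
  have lf_chart: "lf (V, \<phi>) (\<phi> p) = f p" if "(V, \<phi>) \<in> B" "p \<in> V" for V \<phi> p
    using that B(2) chart_inj_on[OF atlas] by (auto simp: lf_def)
  \<comment> \<open>The bad matrices: those for which the differential degenerates somewhere in the chart \<open>c\<close>, and
    those which identify two points of the image of \<open>f\<close>, one from each of the charts \<open>c\<close> and \<open>d\<close>.\<close>
  define crit where "crit = (\<lambda>c. {M :: real^'m^'l. \<exists>x\<in>im c.
    \<not> inj (\<lambda>v. frechet_derivative (F \<circ> lf c) (at x) v + M *v frechet_derivative (lf c) (at x) v)})"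
  define dbl where "dbl = (\<lambda>c d. {M :: real^'m^'l. \<exists>x\<in>im c. \<exists>y\<in>im d.
    lf c x \<noteq> lf d y \<and> (F \<circ> lf c) x + M *v lf c x = (F \<circ> lf d) y + M *v lf d y})"
  define Z where "Z = (\<Union>c\<in>B. crit c) \<union> (\<Union>c\<in>B. \<Union>d\<in>B. dbl c d)"
  have "negligible (crit c)" if "c \<in> B" for c
    unfolding crit_def
  proof (rule negligible_nonimmersive_perturbations[OF dim lf[OF that] lF[OF that]])
    show "inj (frechet_derivative (lf c) (at x))" if "x \<in> im c" for x
      using imm that \<open>c \<in> B\<close> B(2) by (fastforce simp: immersion_def lf_def im_def)
  qed
  moreover have "negligible (dbl c d)" if "c \<in> B" "d \<in> B" for c d
    unfolding dbl_def using lf lF that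
    by (intro negligible_noninjective_perturbations[OF dim] smooth_on_imp_differentiable_on)
  ultimately have "negligible Z"
    unfolding Z_def using B(1) by (intro negligible_Un negligible_Union) auto
  moreover have "smooth_embedding N A UNIV (linear_perturbation F \<pi> \<circ> f)"
    if \<pi>: "linear \<pi>" and good: "matrix \<pi> \<notin> Z" for \<pi>
  proof -
    let ?h = "linear_perturbation F \<pi> \<circ> f"
    have \<pi>_mat: "matrix \<pi> *v x = \<pi> x" for x
      using \<pi> by (metis matrix_vector_mul(2))
    have F\<pi>: "smooth_on (linear_perturbation F \<pi>) U"
      by (rule smooth_on_linear_perturbation[OF assms(3,5) \<pi>])
    have "immersion N A UNIV ?h"
    proof (rule immersion_if_on_cover[OF atlas smooth_map_compose[OF atlas assms(3) smooth F\<pi>] B(2,3)])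
      fix V \<phi> p assume V: "(V, \<phi>) \<in> B" "p \<in> V"
      then have p: "\<phi> p \<in> im (V, \<phi>)" by (simp add: im_def)
      let ?Df = "frechet_derivative (lf (V, \<phi>)) (at (\<phi> p))"
      let ?DF = "frechet_derivative (F \<circ> lf (V, \<phi>)) (at (\<phi> p))"
      have "(lf (V, \<phi>) has_derivative ?Df) (at (\<phi> p))"
        using smooth_on_differentiable[OF lf[OF V(1)] p] by (simp only: frechet_derivative_works)
      moreover have "(F \<circ> lf (V, \<phi>) has_derivative ?DF) (at (\<phi> p))"
        using smooth_on_differentiable[OF lF[OF V(1)] p] by (simp only: frechet_derivative_works)
      moreover have "bounded_linear \<pi>"
        using \<pi> by (simp add: linear_conv_bounded_linear)
      ultimately have "((\<lambda>x. (F \<circ> lf (V, \<phi>)) x + \<pi> (lf (V, \<phi>) x)) has_derivative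
          (\<lambda>v. ?DF v + \<pi> (?Df v))) (at (\<phi> p))"
        by (intro has_derivative_add bounded_linear.has_derivative[of \<pi>])
      note deriv = frechet_derivative_at[OF this]
      have "(\<lambda>x. (F \<circ> lf (V, \<phi>)) x + \<pi> (lf (V, \<phi>) x)) = ?h \<circ> inv_into V \<phi>"
        by (simp add: fun_eq_iff lf_def linear_perturbation_def)
      with deriv have "(\<lambda>v. ?DF v + \<pi> (?Df v)) = frechet_derivative (?h \<circ> inv_into V \<phi>) (at (\<phi> p))"
        by (simp only:)
      moreover have "inj (\<lambda>v. ?DF v + \<pi> (?Df v))"
        using good V p by (auto simp: Z_def crit_def \<pi>_mat)
      ultimately show "inj (frechet_derivative (?h \<circ> inv_into V \<phi>) (at (\<phi> p)))"
        by simp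
    qed simp
    moreover have "embedding_map N (top_of_set UNIV) ?h"
    proof (rule continuous_imp_embedding_map[OF _ assms(2)])
      have "continuous_map N (top_of_set U) f"
        using emb by (auto simp: embedding_map_def homeomorphic_eq_everything_map continuous_map_in_subtopology)
      moreover have "continuous_map (top_of_set U) (top_of_set UNIV) (linear_perturbation F \<pi>)"
        using smooth_on_continuous_on[OF F\<pi>] by simp
      ultimately show "continuous_map N (top_of_set UNIV) ?h"
        by (rule continuous_map_compose)
      show "inj_on ?h (topspace N)"
      proof (rule inj_onI)
        fix p q assume pq: "p \<in> topspace N" "q \<in> topspace N" "?h p = ?h q"
        then obtain V \<phi> W \<psi> where V: "(V, \<phi>) \<in> B" "p \<in> V" and W: "(W, \<psi>) \<in> B" "q \<in> W"
          using B(3) by blast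
        have "f p = f q"
        proof (rule ccontr)
          assume "f p \<noteq> f q"
          then have "matrix \<pi> \<in> dbl (V, \<phi>) (W, \<psi>)"
            unfolding dbl_def mem_Collect_eq using pq(3) V W
            by (intro bexI[of _ "\<phi> p"] bexI[of _ "\<psi> q"])
              (auto simp: lf_chart im_def \<pi>_mat linear_perturbation_def)
          with good V W show False
            by (auto simp: Z_def)
        qed
        then show "p = q"
          using pq emb by (auto simp: embedding_map_def homeomorphic_eq_everything_map dest: inj_onD)
      qed
    qed simp
    ultimately show ?thesis
      by (simp add: smooth_embedding_def)
  qed
  ultimately show ?thesis
    by (intro exI[of _ "{\<pi>. linear \<pi> \<and> matrix \<pi> \<in> Z}"] conjI null_set_of_linear_maps_if_negligible) auto
qed

end
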